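(* Fix integers $m\geq 2$ and $s\geq 2$. Let $A_m\subset\mathbb{S}$ be the set of $2(3^m-1)$ equally spaced points $$A_m=\left\{\frac{\pi(j-1)}{3^m-1}:\ j=1,\ldots,2(3^m-1)\right\},$$ and let $A_{m,s}\subset\mathbb{S}$ be a set consisting of $2(3^m-1)$ clusters of $s$ (distinct) points each, chosen in such a way that for all $j=1,\ldots,2(3^m-1)$ the $j$-th cluster lies on an arc of length $10^{-m}$ that contains the point $\frac{\pi(j-1)}{3^m-1}$, and such that the entire set $A_{m,s}$ is centrally symmetric (i.e. invariant under $t\mapsto t+\pi \bmod 2\pi$). Then: 1. The polytope $P(A_m,m)$ is a centrally symmetric $2$-neighborly polytope of dimension $2(m+1)$ that has $2(3^m-1)$ vertices. 2. The polytope $P(A_{m,s},m)$ is a centrally symmetric $2(m+1)$-dimensional polytope that has $N:=2s(3^m-1)$ vertices and at least $N(N-s-1)/2$ edges, where $N(N-s-1)/2>\left(1-3^{-m}\right)\binom{N}{2}$.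
   Context: $\mathbb{S}=\mathbb{R}/2\pi\mathbb{Z}$ is the unit circle. For an integer $m\ge 1$, $\Phi_m:\mathbb{S}\to\mathbb{R}^{2(m+1)}$ is the curve $\Phi_m(t)=\bigl(\cos t,\sin t,\cos 3t,\sin 3t,\cos 9t,\sin 9t,\ldots,\cos(3^m t),\sin(3^m t)\bigr)$ (frequencies $3^0,3^1,\ldots,3^m$). For a finite set $C\subset\mathbb{S}$, $P(C,m)=\mathrm{conv}(\Phi_m(t):t\in C)$. A polytope $P\subset\mathbb{R}^d$ is centrally symmetric if $P=-P$; two vertices $v,w$ are antipodes if $w=-v$. A centrally symmetric polytope is $k$-neighborly if every set of $k$ of its vertices, no two of which are antipodes, is the vertex set of a $(k-1)$-dimensional face. *)

theory Defs
  imports "HOL-Analysis.Analysis" "HOL-Library.Real_Mod"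
begin

quotient_type circle = real / "\<lambda>x y. [x = y] (rmod (2 * pi))"
proof (rule equivpI)
  show "reflp (\<lambda>x y. [x = y] (rmod (2 * pi)))"
    by (rule reflpI) simp
  show "symp (\<lambda>x y. [x = y] (rmod (2 * pi)))"
    by (rule sympI) (rule rcong_sym)
  show "transp (\<lambda>x y. [x = y] (rmod (2 * pi)))"
    by (rule transpI) (rule rcong_trans)
qed

lift_definition half_turn :: "circle \<Rightarrow> circle" is "\<lambda>t. t + pi"
  by simp

text \<open>The closed arc of length \<open>L\<close> that starts at the class of \<open>a\<close> is the image of the
  interval \<open>{a..a + L}\<close>; it may pass through the class of \<open>0\<close>.\<close>

definition circle_arc :: "real \<Rightarrow> circle set \<Rightarrow> bool" where
  "circle_arc L I \<longleftrightarrow> (\<exists>a. I = abs_circle ` {a..a + L})"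

lemma cos_sin_rcong:
  assumes "[x = y] (rmod (2 * pi))"
  shows "cos (3 ^ k * x) = cos (3 ^ k * y)" "sin (3 ^ k * x) = sin (3 ^ k * y)"
proof -
  from assms obtain n :: int where n: "y = x + of_int n * (2 * pi)"
    by (auto simp: rcong_altdef)
  have "3 ^ k * y = 3 ^ k * x + 2 * pi * of_int (3 ^ k * n)"
    by (simp add: n algebra_simps)
  then show "cos (3 ^ k * x) = cos (3 ^ k * y)" "sin (3 ^ k * x) = sin (3 ^ k * y)"
    by (simp_all only: cos_add sin_add cos_int_2pin sin_int_2pin)
qed

text \<open>The curve \<open>t \<mapsto> (cos t, sin t, cos 3t, sin 3t, \<dots>, cos (3\<^sup>m t), sin (3\<^sup>m t))\<close> in the space
  of dimension \<open>2(m + 1)\<close>. The dimension is \<open>CARD('n)\<close>, and the argument \<open>e\<close> lists the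
  coordinates: it is meant to be a bijection from \<open>'n\<close> to \<open>{..<2 * (m + 1)}\<close>, which also
  determines \<open>m\<close>. Coordinate number \<open>2k\<close> (counted from \<open>0\<close>) is \<open>cos (3\<^sup>k t)\<close> and coordinate
  number \<open>2k + 1\<close> is \<open>sin (3\<^sup>k t)\<close>.\<close>

lift_definition Phi :: "('n::finite \<Rightarrow> nat) \<Rightarrow> circle \<Rightarrow> real ^ 'n" is
  "\<lambda>e t. \<chi> i. if even (e i) then cos (3 ^ (e i div 2) * t) else sin (3 ^ (e i div 2) * t)"
  by (simp add: vec_eq_iff cos_sin_rcong)

definition curve_polytope :: "('n::finite \<Rightarrow> nat) \<Rightarrow> circle set \<Rightarrow> (real ^ 'n) set" where
  "curve_polytope e C = convex hull (Phi e ` C)"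

definition vertices :: "'a::real_vector set \<Rightarrow> 'a set" where
  "vertices P = {v. v extreme_point_of P}"

definition centrally_symmetric :: "'a::real_vector set \<Rightarrow> bool" where
  "centrally_symmetric P \<longleftrightarrow> P = uminus ` P"

definition cs_neighborly :: "nat \<Rightarrow> 'a::euclidean_space set \<Rightarrow> bool" where
  "cs_neighborly k P \<longleftrightarrow> polytope P \<and> centrally_symmetric P \<and>
     (\<forall>V. V \<subseteq> vertices P \<and> card V = k \<and> pairwise (\<lambda>v w. w \<noteq> - v) V \<longrightarrow>
        (\<exists>F. F face_of P \<and> aff_dim F = int k - 1 \<and> vertices F = V))"

definition node :: "nat \<Rightarrow> nat \<Rightarrow> circle" where
  "node m j = abs_circle (pi * (real j - 1) / (3 ^ m - 1))"

definition A_points :: "nat \<Rightarrow> circle set" where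
  "A_points m = node m ` {1..2 * (3 ^ m - 1)}"

definition clustered :: "nat \<Rightarrow> nat \<Rightarrow> circle set \<Rightarrow> bool" where
  "clustered m s A \<longleftrightarrow>
     (\<exists>K :: nat \<Rightarrow> circle set.
        A = (\<Union>j\<in>{1..2 * (3 ^ m - 1)}. K j) \<and>
        (\<forall>j\<in>{1..2 * (3 ^ m - 1)}. finite (K j) \<and> card (K j) = s \<and>
           (\<exists>I. circle_arc (1 / 10 ^ m) I \<and> node m j \<in> I \<and> K j \<subseteq> I))) \<and>
     half_turn ` A = A"

end

theory Submission
  imports Defs
begin

text \<open>For \<open>c = cos \<theta>\<close> with \<open>\<bar>c\<bar> > 1/2\<close>, the trigonometric polynomial
  \<open>(cos (t - \<mu>) - c)\<^sup>2 (cos (t - \<mu>) + 2 c)\<close> has only the frequencies \<open>0, 1, 3\<close>, does not change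
  sign, and vanishes exactly at \<open>t = \<mu> \<plusminus> \<theta>\<close>. Substituting \<open>3\<^sup>k t\<close> for \<open>t\<close>, with \<open>k < m\<close>,
  gives a supporting hyperplane of the polytope through the points with parameters \<open>x\<close> and \<open>y\<close>
  whenever \<open>cos (3\<^sup>k (x - y)) > -1/2\<close>. Because \<open>3\<^sup>k\<close> is coprime to \<open>2(3\<^sup>m - 1)\<close> and the clusters are
  small, the hyperplane meets no other point of the set. If no such \<open>k\<close> exists, then \<open>x - y\<close> is
  within \<open>\<pi>/3\<^sup>m\<close> of \<open>\<pi>\<close>, which forces \<open>x\<close> and \<open>y\<close> into antipodal clusters. The case \<open>x = y\<close> shows
  that all points are vertices. The dimension is full because a nonzero trigonometric
  polynomial of degree \<open>d\<close> has at most \<open>2d\<close> zeros.\<close>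

section \<open>Trigonometric polynomials of frequencies 1 and 3 that attain their maximum at two
  given angles\<close>

text \<open>As a cubic in \<open>cos u\<close> the product has the roots \<open>c\<close>,
  \<open>c\<close>, \<open>- 2 * c\<close>, whose sum is 0. So there is no \<open>cos u\<close>
  squared term, hence no frequency 2, and the cube is rewritten by the triple angle formula.\<close>

lemma trig_double_zero:
  fixes c u :: real
  shows "(cos u - c)\<^sup>2 * (cos u + 2 * c) = cos (3 * u) / 4 + (3 / 4 - 3 * c\<^sup>2) * cos u + 2 * c ^ 3"
  unfolding cos_treble_cos by (simp add: power2_eq_square power3_eq_cube field_simps)

text \<open>Since \<open>2 * \<bar>c\<bar> > 1\<close>, the factor \<open>cos u + 2 * c\<close>
  never vanishes and always has the sign of \<open>c\<close>; the other factor is a square.\<close>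

lemma trig_double_zero_nonneg:
  fixes c u :: real
  assumes "\<bar>c\<bar> > 1 / 2"
  shows "sgn c * ((cos u - c)\<^sup>2 * (cos u + 2 * c)) \<ge> 0"
    and "sgn c * ((cos u - c)\<^sup>2 * (cos u + 2 * c)) = 0 \<longleftrightarrow> cos u = c"
proof -
  have pos: "sgn c * (cos u + 2 * c) > 0"
  proof (cases "c > 0")
    case True
    then have "cos u + 2 * c > 0"
      using assms cos_ge_minus_one[of u] by linarith
    then show ?thesis using True by simp
  next
    case False
    then have "c < 0" "cos u + 2 * c < 0"
      using assms cos_le_one[of u] by linarith+
    then show ?thesis by (simp add: mult_neg_neg)
  qed
  have eq: "sgn c * ((cos u - c)\<^sup>2 * (cos u + 2 * c)) = (cos u - c)\<^sup>2 * (sgn c * (cos u + 2 * c))"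
    by (simp add: algebra_simps)
  show "sgn c * ((cos u - c)\<^sup>2 * (cos u + 2 * c)) \<ge> 0"
    unfolding eq using pos by simp
  show "sgn c * ((cos u - c)\<^sup>2 * (cos u + 2 * c)) = 0 \<longleftrightarrow> cos u = c"
    unfolding eq using pos by auto
qed

text \<open>For \<open>c = cos ((x - y) / 2)\<close> the double angle formula turns the hypothesis
  into \<open>\<bar>c\<bar> > 1 / 2\<close>. Equal angles are allowed: then \<open>c = 1\<close> and
  the two contact points coincide.\<close>

lemma ex_trig_two_zeros:
  fixes x y :: real
  assumes "cos (x - y) > - (1 / 2)"
  shows "\<exists>a1 b1 a3 b3 d. \<forall>t.
    a1 * cos t + b1 * sin t + a3 * cos (3 * t) + b3 * sin (3 * t) \<le> d \<and>
    (a1 * cos t + b1 * sin t + a3 * cos (3 * t) + b3 * sin (3 * t) = d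
      \<longleftrightarrow> (\<exists>n::int. t = x + 2 * pi * n \<or> t = y + 2 * pi * n))"
proof -
  define \<mu> where "\<mu> = (x + y) / 2"
  define \<theta> where "\<theta> = (x - y) / 2"
  define c where "c = cos \<theta>"
  have "x - y = 2 * \<theta>" by (simp add: \<theta>_def)
  then have "cos (x - y) = 2 * c\<^sup>2 - 1"
    unfolding c_def by (simp only: cos_double_cos)
  with assms have "c\<^sup>2 > (1 / 2)\<^sup>2" by (simp add: power2_eq_square)
  then have c: "\<bar>c\<bar> > 1 / 2"
    by (metis abs_of_nonneg abs_le_square_iff not_le zero_le_divide_1_iff zero_le_numeral)
  let ?T = "\<lambda>u. sgn c * ((cos u - c)\<^sup>2 * (cos u + 2 * c))"
  \<comment> \<open>These are the coefficients of \<open>cos u\<close> and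
    \<open>cos (3 * u)\<close> in \<open>trig_double_zero\<close>, times \<open>- sgn c\<close>. The
    minus sign turns the minimum 0 of \<open>?T\<close> into a maximum, and the constant term
    becomes the bound \<open>2 * sgn c * c ^ 3\<close>.\<close>
  let ?a = "- sgn c * (3 / 4 - 3 * c\<^sup>2)" and ?b = "- sgn c / 4"
  have zero: "?T (t - \<mu>) = 0 \<longleftrightarrow> (\<exists>n::int. t = x + 2 * pi * n \<or> t = y + 2 * pi * n)" for t
  proof -
    have "?T (t - \<mu>) = 0 \<longleftrightarrow> cos (t - \<mu>) = c"
      by (rule trig_double_zero_nonneg(2)[OF c])
    also have "\<dots> \<longleftrightarrow> (\<exists>n::int. t - \<mu> = \<theta> + 2 * n * pi \<or> t - \<mu> = - \<theta> + 2 * n * pi)"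
      unfolding c_def cos_eq by (auto simp: Ints_def)
    also have "\<dots> \<longleftrightarrow> (\<exists>n::int. t = x + 2 * pi * n \<or> t = y + 2 * pi * n)"
    proof -
      have "x = \<mu> + \<theta>" "y = \<mu> - \<theta>"
        by (simp_all add: \<mu>_def \<theta>_def field_simps)
      then have "t - \<mu> = \<theta> + r \<longleftrightarrow> t = x + r" "t - \<mu> = - \<theta> + r \<longleftrightarrow> t = y + r" for r
        by auto
      then show ?thesis
        by (simp add: mult_ac)
    qed
    finally show ?thesis .
  qed
  have "?a * cos \<mu> * cos t + ?a * sin \<mu> * sin t + ?b * cos (3 * \<mu>) * cos (3 * t) + ?b * sin (3 * \<mu>) * sin (3 * t)
      = 2 * sgn c * c ^ 3 - ?T (t - \<mu>)" for t
  proof -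
    have "cos (3 * (t - \<mu>)) = cos (3 * t) * cos (3 * \<mu>) + sin (3 * t) * sin (3 * \<mu>)"
      by (simp add: right_diff_distrib cos_diff)
    then show ?thesis
      unfolding trig_double_zero by (simp add: cos_diff algebra_simps)
  qed
  then have "?a * cos \<mu> * cos t + ?a * sin \<mu> * sin t + ?b * cos (3 * \<mu>) * cos (3 * t)
        + ?b * sin (3 * \<mu>) * sin (3 * t) \<le> 2 * sgn c * c ^ 3 \<and>
      (?a * cos \<mu> * cos t + ?a * sin \<mu> * sin t + ?b * cos (3 * \<mu>) * cos (3 * t)
        + ?b * sin (3 * \<mu>) * sin (3 * t) = 2 * sgn c * c ^ 3
       \<longleftrightarrow> (\<exists>n::int. t = x + 2 * pi * n \<or> t = y + 2 * pi * n))" for t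
    using trig_double_zero_nonneg(1)[OF c, of "t - \<mu>"] zero[of t] by auto
  then show ?thesis by blast
qed

section \<open>Zeros of trigonometric sums whose frequencies are powers of 3\<close>

text \<open>Multiplied by \<open>2 * z ^ D\<close>, where \<open>z = cis t\<close> and
  \<open>D = 3 ^ d\<close>, the sum becomes a complex polynomial in \<open>z\<close> of degree at
  most \<open>2 * D\<close>. It has more than \<open>2 * D\<close> distinct roots, so it is 0, and
  its coefficients encode \<open>a\<close> and \<open>b\<close>.\<close>

lemma trig_sum_eq_0_imp:
  fixes a b :: "nat \<Rightarrow> real" and x :: "'i \<Rightarrow> real"
  assumes card: "card T > 2 * 3 ^ d" and inj: "inj_on (\<lambda>i. cis (x i)) T"
    and zero: "\<And>i. i \<in> T \<Longrightarrow> (\<Sum>k\<le>d. a k * cos (3 ^ k * x i) + b k * sin (3 ^ k * x i)) = 0"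
    and "k \<le> d"
  shows "a k = 0" "b k = 0"
proof -
  define D :: nat where "D = 3 ^ d"
  define p where "p = (\<Sum>k\<le>d. monom (Complex (a k) (- b k)) (D + 3 ^ k)
    + monom (Complex (a k) (b k)) (D - 3 ^ k))"
  have le: "3 ^ k \<le> D" if "k \<le> d" for k
    unfolding D_def using that by (simp add: power_increasing)
  have "poly p (cis t) = 2 * cis t ^ D *
      complex_of_real (\<Sum>k\<le>d. a k * cos (3 ^ k * t) + b k * sin (3 ^ k * t))" for t
  proof -
    have "Complex (a k) (- b k) * cis t ^ (D + 3 ^ k) + Complex (a k) (b k) * cis t ^ (D - 3 ^ k)
        = 2 * cis t ^ D * complex_of_real (a k * cos (3 ^ k * t) + b k * sin (3 ^ k * t))"
      if k: "k \<le> d" for k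
    proof -
      let ?w = "Complex (a k) (- b k)" and ?w' = "Complex (a k) (b k)"
      have minus: "cis t ^ (D - 3 ^ k) = cis t ^ D * cis (- (3 ^ k * t))"
        using le[OF k] by (simp add: Complex.DeMoivre cis_mult left_diff_distrib of_nat_diff)
      have plus: "cis t ^ (D + 3 ^ k) = cis t ^ D * cis (3 ^ k * t)"
        by (simp add: Complex.DeMoivre cis_mult distrib_right)
      have real: "?w * cis (3 ^ k * t) + ?w' * cis (- (3 ^ k * t))
          = 2 * complex_of_real (a k * cos (3 ^ k * t) + b k * sin (3 ^ k * t))"
        by (simp add: complex_eq_iff)
      have "?w * cis t ^ (D + 3 ^ k) + ?w' * cis t ^ (D - 3 ^ k)
          = cis t ^ D * (?w * cis (3 ^ k * t) + ?w' * cis (- (3 ^ k * t)))"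
        unfolding plus minus by (simp only: distrib_left mult.left_commute)
      then show ?thesis
        unfolding real by (simp only: mult_ac)
    qed
    then show ?thesis
      by (simp add: p_def poly_sum poly_monom sum_distrib_left)
  qed
  then have "poly p (cis (x i)) = 0" if "i \<in> T" for i
    by (simp only: zero[OF that] of_real_0 mult_zero_right)
  then have roots: "(\<lambda>i. cis (x i)) ` T \<subseteq> {z. poly p z = 0}"
    by blast
  have "p = 0"
  proof (rule ccontr)
    assume "p \<noteq> 0"
    then have "card ((\<lambda>i. cis (x i)) ` T) \<le> card {z. poly p z = 0}"
      by (intro card_mono roots poly_roots_finite)
    also have "\<dots> \<le> degree p"
      by (rule card_poly_roots_bound[OF \<open>p \<noteq> 0\<close>])
    also have "degree p \<le> 2 * D"
      unfolding p_def
    proof (rule degree_sum_le)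
      fix k assume "k \<in> {..d}"
      then have "3 ^ k \<le> D" by (simp add: le)
      then have "degree (monom (Complex (a k) (- b k)) (D + 3 ^ k)) \<le> 2 * D"
        "degree (monom (Complex (a k) (b k)) (D - 3 ^ k)) \<le> 2 * D"
        by (auto intro: order.trans[OF degree_monom_le])
      then show "degree (monom (Complex (a k) (- b k)) (D + 3 ^ k)
          + monom (Complex (a k) (b k)) (D - 3 ^ k)) \<le> 2 * D"
        by (rule degree_add_le)
    qed simp
    finally show False
      using card inj by (simp add: card_image D_def)
  qed
  \<comment> \<open>The exponents \<open>D + 3 ^ j\<close> are pairwise distinct and exceed all
    exponents \<open>D - 3 ^ j\<close>, so a single monomial contributes.\<close>
  have "coeff p (D + 3 ^ k) = (\<Sum>j\<le>d. if j = k then Complex (a k) (- b k) else 0)"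
    unfolding p_def coeff_sum
  proof (intro sum.cong refl)
    fix j assume "j \<in> {..d}"
    have "D - 3 ^ j \<noteq> D + 3 ^ k"
      using zero_less_power[of "3::nat" k] by linarith
    then show "coeff (monom (Complex (a j) (- b j)) (D + 3 ^ j) + monom (Complex (a j) (b j)) (D - 3 ^ j))
        (D + 3 ^ k) = (if j = k then Complex (a k) (- b k) else 0)"
      by simp
  qed
  also have "\<dots> = Complex (a k) (- b k)"
    using \<open>k \<le> d\<close> by simp
  finally have "Complex (a k) (- b k) = 0"
    using \<open>p = 0\<close> by simp
  then show "a k = 0" "b k = 0"
    by (simp_all add: complex_eq_iff)
qed

section \<open>Arithmetic of angles close to the nodes\<close>

text \<open>The arc length \<open>1 / 10 ^ m\<close> beats the product of two factors of at most
  \<open>3 ^ m\<close>: the left side is at most \<open>2 * (9 / 10) ^ m\<close>.\<close>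

lemma cluster_radius_bound: "2 * 3 ^ k * (3 ^ m - 1) / 10 ^ m < pi" if "k \<le> m" for k m :: nat
proof -
  have "2 * 3 ^ k * (3 ^ m - 1) / 10 ^ m \<le> 2 * 3 ^ m * (3 ^ m) / (10 ^ m :: real)"
    using that by (intro divide_right_mono mult_mono) (auto simp: power_increasing)
  also have "\<dots> = 2 * (9 / 10) ^ m"
    by (simp add: power_divide flip: power_mult_distrib)
  also have "\<dots> \<le> 2 * 1"
    by (intro mult_left_mono power_le_one) auto
  also have "\<dots> < pi"
    using pi_gt3 by simp
  finally show ?thesis .
qed

text \<open>Two points deviate from their nodes by at most \<open>2 / 10 ^ m\<close> together. Even
  after stretching by \<open>3 ^ k\<close> this stays below the distance of neighbouring
  nodes.\<close>

lemma cluster_gap: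
  fixes m k :: nat
  assumes "m \<ge> 1" "k \<le> m"
  shows "2 * 3 ^ k / 10 ^ m < pi / (3 ^ m - 1)"
  using cluster_radius_bound[OF \<open>k \<le> m\<close>] assms
  by (simp add: pos_less_divide_eq algebra_simps)

lemma int_eq_0_if_small:
  fixes r :: int and M :: real
  assumes "M > 0" "\<bar>pi * r / M\<bar> < pi / M"
  shows "r = 0"
proof -
  have "\<bar>r\<bar> < (1 :: real)"
    using assms by (simp add: abs_mult field_simps)
  then show ?thesis by linarith
qed

lemma coprime_three_power: "coprime (3 ^ k :: int) (2 * (3 ^ m - 1))" if "m \<ge> 1" for k m :: nat
proof -
  have "\<not> (3::int) dvd 2 * (3 ^ m - 1)"
  proof
    assume "(3::int) dvd 2 * (3 ^ m - 1)"
    moreover have "(3::int) dvd 2 * 3 ^ m"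
      using that by (simp add: dvd_power dvd_mult)
    ultimately have "(3::int) dvd 2 * 3 ^ m - 2 * (3 ^ m - 1)"
      by (rule dvd_diff[rotated])
    then show False by simp
  qed
  then have "coprime (3::int) (2 * (3 ^ m - 1))"
    by (intro prime_imp_coprime) auto
  then show ?thesis by simp
qed

text \<open>Stretching by \<open>3 ^ k\<close> keeps the deviations below one node spacing, so the
  node indices satisfy \<open>3 ^ k * (p - q) = 2 * l * M\<close> exactly. As \<open>3 ^ k\<close>
  is coprime to \<open>2 * M\<close>, it divides \<open>l\<close> and cancels from both
  equations.\<close>

lemma cluster_point_unique:
  fixes p q l :: int and x y :: real
  assumes "m \<ge> 1" "k \<le> m"
    and x: "\<bar>x - pi * p / (3 ^ m - 1)\<bar> \<le> 1 / 10 ^ m"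
    and y: "\<bar>y - pi * q / (3 ^ m - 1)\<bar> \<le> 1 / 10 ^ m"
    and xy: "3 ^ k * (x - y) = 2 * pi * l"
  obtains l' :: int where "x - y = 2 * pi * l'" "p - q = 2 * l' * (3 ^ m - 1)"
proof -
  define M where "M = (3::int) ^ m - 1"
  have M: "(3::real) ^ m - 1 = of_int M" and M_pos: "M > 0"
    using \<open>m \<ge> 1\<close> by (auto simp: M_def)
  define r where "r = 3 ^ k * (p - q) - 2 * l * M"
  define \<xi> \<eta> where "\<xi> = x - pi * p / M" and "\<eta> = y - pi * q / M"
  have "pi * r / M = 3 ^ k * (\<eta> - \<xi>)"
  proof -
    have "pi * r / M = 3 ^ k * (pi * p / M - pi * q / M) - 2 * pi * l"
      using M_pos by (simp add: r_def field_simps)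
    also have "\<dots> = 3 ^ k * (\<eta> - \<xi>)"
      using xy by (simp add: \<xi>_def \<eta>_def algebra_simps)
    finally show ?thesis .
  qed
  moreover have "\<bar>\<eta> - \<xi>\<bar> \<le> 2 / 10 ^ m"
    using x y unfolding M \<xi>_def[symmetric] \<eta>_def[symmetric] by (simp add: abs_if split: if_splits)
  ultimately have "\<bar>pi * r / M\<bar> \<le> 3 ^ k * (2 / 10 ^ m)"
    by (metis abs_mult abs_of_pos mult_left_mono zero_less_numeral zero_less_power less_imp_le)
  also have "\<dots> < pi / M"
    using cluster_gap[OF assms(1,2)] unfolding M by (simp add: mult.commute)
  finally have "r = 0"
    using M_pos by (intro int_eq_0_if_small[of M]) auto
  then have eq: "3 ^ k * (p - q) = l * (2 * M)"
    by (simp add: r_def)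
  then have "3 ^ k dvd l"
    using coprime_three_power[OF \<open>m \<ge> 1\<close>, of k] unfolding M_def[symmetric]
    by (metis coprime_dvd_mult_left_iff dvd_triv_left)
  then obtain l' where l': "l = 3 ^ k * l'" by (elim dvdE)
  have "3 ^ k * (p - q) = 3 ^ k * (2 * l' * M)"
    unfolding eq l' by simp
  then have 1: "p - q = 2 * l' * M"
    by simp
  have "3 ^ k * (x - y) = 3 ^ k * (2 * pi * l')"
    using xy by (simp add: l')
  then have "x - y = 2 * pi * l'" by simp
  with 1 show ?thesis using that unfolding M_def by blast
qed

lemma cos_sin_add_odd_pi:
  fixes q :: int and x :: real
  assumes "odd q"
  shows "cos (x + pi * q) = - cos x" "sin (x + pi * q) = - sin x"
proof -
  obtain n where q: "q = 2 * n + 1"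
    using assms by (elim oddE)
  have eq: "x + pi * q = x + 2 * pi * n + pi"
    by (simp add: q algebra_simps)
  show "cos (x + pi * q) = - cos x" "sin (x + pi * q) = - sin x"
    unfolding eq cos_periodic_pi sin_periodic_pi
    by (simp_all only: cos_add sin_add cos_int_2pin sin_int_2pin mult_1_right mult_zero_right diff_zero add_0_right)
qed

text \<open>Every frequency cuts the distance \<open>\<bar>z\<bar>\<close> to the nearest odd
  multiple of \<open>pi\<close> by a factor of 3. An odd multiple of \<open>pi\<close> stays one
  under stretching, so \<open>cos (3 ^ m * u) = - cos (3 ^ m * z)\<close>, and from
  \<open>\<bar>3 ^ m * z\<bar> \<le> pi\<close> the bound on the cosine yields
  \<open>\<bar>3 ^ m * z\<bar> \<le> pi / 3\<close>.\<close>

lemma near_antipode: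
  fixes u :: real
  assumes "\<And>k. k < m \<Longrightarrow> cos (3 ^ k * u) \<le> - (1 / 2)"
  shows "\<exists>n::int. \<bar>u - pi - 2 * pi * n\<bar> \<le> pi / 3 ^ m"
  using assms
proof (induction m)
  case 0
  define n where "n = \<lfloor>u / (2 * pi)\<rfloor>"
  have "n \<le> u / (2 * pi)" "u / (2 * pi) < n + 1"
    unfolding n_def by linarith+
  then have "2 * pi * n \<le> u" "u < 2 * pi * n + 2 * pi"
    by (simp_all add: field_simps)
  then show ?case
    by (intro exI[of _ n]) (simp add: abs_le_iff)
next
  case (Suc m)
  then obtain n :: int where n: "\<bar>u - pi - 2 * pi * n\<bar> \<le> pi / 3 ^ m"
    by force
  define z where "z = u - pi - 2 * pi * n"
  have "3 ^ m * u = 3 ^ m * z + pi * of_int (3 ^ m * (2 * n + 1))"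
    by (simp add: z_def algebra_simps)
  then have "cos (3 ^ m * u) = - cos (3 ^ m * z)"
    using cos_sin_add_odd_pi(1)[of "3 ^ m * (2 * n + 1)" "3 ^ m * z"] by simp
  then have "cos \<bar>3 ^ m * z\<bar> \<ge> cos (pi / 3)"
    using Suc.prems[of m] by (simp add: cos_60 abs_if)
  moreover have "\<bar>3 ^ m * z\<bar> \<le> pi"
    using n unfolding z_def[symmetric] by (simp add: abs_mult field_simps)
  ultimately have "\<bar>3 ^ m * z\<bar> \<le> pi / 3"
    using cos_mono_le_eq[of "pi / 3" "\<bar>3 ^ m * z\<bar>"] by simp
  then have "\<bar>z\<bar> \<le> pi / 3 ^ Suc m"
    by (simp add: abs_mult field_simps)
  then show ?case
    unfolding z_def by blast
qed

text \<open>The distance to an odd multiple of \<open>pi\<close> from \<open>near_antipode\<close>,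
  plus both deviations, is less than one node spacing, so the nodes themselves differ by exactly
  that multiple.\<close>

lemma near_antipode_clusters:
  fixes p q :: int and x y :: real
  assumes "m \<ge> 1"
    and x: "\<bar>x - pi * p / (3 ^ m - 1)\<bar> \<le> 1 / 10 ^ m"
    and y: "\<bar>y - pi * q / (3 ^ m - 1)\<bar> \<le> 1 / 10 ^ m"
    and cos: "\<And>k. k < m \<Longrightarrow> cos (3 ^ k * (x - y)) \<le> - (1 / 2)"
  shows "\<exists>n::int. p - q = (2 * n + 1) * (3 ^ m - 1)"
proof -
  define M where "M = (3::int) ^ m - 1"
  have M: "(3::real) ^ m - 1 = of_int M" and M_pos: "M > 0"
    using \<open>m \<ge> 1\<close> by (auto simp: M_def)
  obtain n :: int where n: "\<bar>x - y - pi - 2 * pi * n\<bar> \<le> pi / 3 ^ m"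
    using near_antipode[OF cos] by blast
  define r where "r = p - q - (2 * n + 1) * M"
  have "pi * r / M = pi * p / M - pi * q / M - pi - 2 * pi * n"
    using M_pos by (simp add: r_def field_simps)
  then have "\<bar>pi * r / M\<bar> \<le> pi / 3 ^ m + 2 / 10 ^ m"
    using n x y unfolding M by linarith
  also have "\<dots> < pi / M"
  proof -
    \<comment> \<open>Since \<open>3 ^ m = M + 1\<close>, the available slack
      \<open>pi / M - pi / 3 ^ m\<close> equals \<open>pi / (3 ^ m * M)\<close>; the gap bound for
      \<open>k = m\<close> is just what fits below it.\<close>
    have "3 ^ m * (2 / 10 ^ m) < pi / M"
      using cluster_gap[of m m] \<open>m \<ge> 1\<close> unfolding M by (simp add: mult.commute)
    also have "\<dots> = 3 ^ m * (pi / M - pi / 3 ^ m)"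
    proof -
      have "(3::real) ^ m = of_int M + 1"
        using M by simp
      moreover have "3 ^ m * (pi / M - pi / 3 ^ m) = 3 ^ m * (pi / M) - pi"
        by (simp add: right_diff_distrib)
      ultimately show ?thesis
        using M_pos by (simp add: field_simps)
    qed
    finally have "2 / 10 ^ m < pi / M - pi / 3 ^ m"
      by (simp only: mult_less_cancel_left_pos zero_less_power zero_less_numeral)
    then show ?thesis by simp
  qed
  finally have "r = 0"
    using M_pos by (intro int_eq_0_if_small[of M]) auto
  then show ?thesis unfolding r_def M_def by auto
qed

section \<open>The curve, its linear functionals and supporting hyperplanes\<close>

lemma Phi_component:
  "Phi e (abs_circle t) $ i =
    (if even (e i) then cos (3 ^ (e i div 2) * t) else sin (3 ^ (e i div 2) * t))"
  by (simp add: Phi.abs_eq)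

text \<open>Normal vectors are described by the cosine and sine coefficients of the trigonometric
  sum that they induce along the curve.\<close>

definition trig_vec :: "('n::finite \<Rightarrow> nat) \<Rightarrow> (nat \<Rightarrow> real) \<Rightarrow> (nat \<Rightarrow> real) \<Rightarrow> real ^ 'n" where
  "trig_vec e a b = (\<chi> i. if even (e i) then a (e i div 2) else b (e i div 2))"

lemma inner_trig_vec_Phi:
  fixes e :: "'n::finite \<Rightarrow> nat"
  assumes e: "bij_betw e UNIV {..<2 * (m + 1)}"
  shows "trig_vec e a b \<bullet> Phi e (abs_circle t) = (\<Sum>k\<le>m. a k * cos (3 ^ k * t) + b k * sin (3 ^ k * t))"
proof -
  let ?g = "\<lambda>l. if even l then a (l div 2) * cos (3 ^ (l div 2) * t)
    else b (l div 2) * sin (3 ^ (l div 2) * t)"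
  have "trig_vec e a b \<bullet> Phi e (abs_circle t) = (\<Sum>i\<in>UNIV. ?g (e i))"
    unfolding inner_vec_def by (intro sum.cong) (auto simp: trig_vec_def Phi_component)
  also have "\<dots> = (\<Sum>l<2 * (m + 1). ?g l)"
    by (rule sum.reindex_bij_betw[OF e])
  also have "(\<Sum>l<2 * n. ?g l) = (\<Sum>k<n. a k * cos (3 ^ k * t) + b k * sin (3 ^ k * t))" for n
    by (induction n) simp_all
  also have "{..<m + 1} = {..m}" by auto
  finally show ?thesis .
qed

lemma trig_vec_surj:
  fixes e :: "'n::finite \<Rightarrow> nat"
  assumes e: "inj e"
  obtains a b where "v = trig_vec e a b"
proof
  show "v = trig_vec e (\<lambda>k. v $ inv e (2 * k)) (\<lambda>k. v $ inv e (2 * k + 1))"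
    using e by (auto simp: vec_eq_iff trig_vec_def odd_two_times_div_two_succ[symmetric])
qed

text \<open>The two coordinates of frequency 1 already determine the point of the circle.\<close>

lemma inj_Phi:
  fixes e :: "'n::finite \<Rightarrow> nat"
  assumes e: "bij_betw e UNIV {..<2 * (m + 1)}"
  shows "inj (Phi e)"
proof (rule injI)
  fix s t assume eq: "Phi e s = Phi e t"
  obtain x y where xy: "s = abs_circle x" "t = abs_circle y"
    using circle.abs_induct[of "\<lambda>s. \<exists>x. s = abs_circle x"] by blast
  have "{0, 1} \<subseteq> range e"
    using bij_betw_imp_surj_on[OF e] by auto
  then obtain i j where ij: "e i = 0" "e j = 1"
    by (metis image_iff insert_subset)
  have "cos x = cos y" "sin x = sin y"
    using arg_cong[OF eq, of "\<lambda>v. v $ i"] arg_cong[OF eq, of "\<lambda>v. v $ j"]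
    by (simp_all add: xy Phi_component ij)
  then have "cis x = cis y" by (simp add: complex_eq_iff)
  then show "s = t"
    by (simp add: xy cis_eq_iff circle.abs_eq_iff)
qed

text \<open>All frequencies are odd, so a half turn shifts every argument by an odd multiple of
  \<open>pi\<close>. This is the source of the central symmetry.\<close>

lemma Phi_half_turn: "Phi e (half_turn t) = - Phi e t"
proof (induction t rule: circle.abs_induct)
  case (1 t)
  have "3 ^ k * (t + pi) = 3 ^ k * t + pi * of_int (3 ^ k)" "odd (3 ^ k :: int)" for k :: nat
    by (simp_all add: algebra_simps)
  then have "cos (3 ^ k * (t + pi)) = - cos (3 ^ k * t)" "sin (3 ^ k * (t + pi)) = - sin (3 ^ k * t)" for k :: nat
    by (simp_all only: cos_sin_add_odd_pi not_False_eq_True)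
  then show ?case
    by (simp add: vec_eq_iff half_turn.abs_eq Phi_component)
qed

text \<open>A supporting hyperplane cuts out a face, and a face of the hull of a finite set is
  spanned by a subset of that set. The spanning points lie on the hyperplane.\<close>

lemma face_of_convex_hull_Int_hyperplane:
  fixes S :: "'a::euclidean_space set"
  assumes "finite S" "\<And>x. x \<in> S \<Longrightarrow> v \<bullet> x \<le> d"
  shows "convex hull {x \<in> S. v \<bullet> x = d} face_of convex hull S"
proof -
  have "convex hull S \<subseteq> {x. v \<bullet> x \<le> d}"
    using assms(2) by (intro hull_minimal convex_halfspace_le) auto
  then have F: "(convex hull S \<inter> {x. v \<bullet> x = d}) face_of convex hull S" (is "?F face_of _")
    by (intro face_of_Int_supporting_hyperplane_le) auto
  then obtain S' where S': "S' \<subseteq> S" "?F = convex hull S'"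
    using assms(1) face_of_convex_hull_subset finite_imp_compact by metis
  have "?F \<subseteq> convex hull {x \<in> S. v \<bullet> x = d}"
    unfolding S'(2) using S' hull_subset[of S' convex] by (intro hull_mono) auto
  moreover have "convex hull {x \<in> S. v \<bullet> x = d} \<subseteq> ?F"
    by (intro hull_minimal convex_Int convex_convex_hull convex_hyperplane) (auto intro: hull_inc)
  ultimately show ?thesis
    using F by auto
qed

section \<open>Representing angles, antipodal indices and segments\<close>

lemma abs_circle_eq_iff: "abs_circle x = abs_circle y \<longleftrightarrow> (\<exists>n::int. y = x + of_int n * (2 * pi))"
  by (simp add: circle.abs_eq_iff rcong_altdef)

text \<open>An arc gives representatives of both points at distance at most \<open>L\<close>.
  Shifting by the multiple of \<open>2 * pi\<close> that moves the representative of the node to its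
  standard angle makes arcs through the class of 0 unexceptional.\<close>

lemma near_node:
  assumes "circle_arc L I" "node m j \<in> I" "t \<in> I"
  shows "\<exists>x. t = abs_circle x \<and> \<bar>x - pi * of_int (int j - 1) / (3 ^ m - 1)\<bar> \<le> L"
proof -
  obtain c where I: "I = abs_circle ` {c..c + L}"
    using assms(1) by (auto simp: circle_arc_def)
  obtain u v where u: "node m j = abs_circle u" "u \<in> {c..c + L}" and v: "t = abs_circle v" "v \<in> {c..c + L}"
    using assms(2,3) unfolding I by blast
  obtain n :: int where n: "u = pi * (real j - 1) / (3 ^ m - 1) + of_int n * (2 * pi)"
    using u(1) unfolding node_def by (metis abs_circle_eq_iff)
  have "abs_circle v = abs_circle (v - of_int n * (2 * pi))"
    by (auto simp: abs_circle_eq_iff intro!: exI[of _ "- n"])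
  moreover have "\<bar>v - of_int n * (2 * pi) - pi * of_int (int j - 1) / (3 ^ m - 1)\<bar> \<le> L"
    using u(2) v(2) n by (auto simp: abs_le_iff)
  ultimately show ?thesis
    using v(1) by blast
qed

definition antipodal_index :: "nat \<Rightarrow> nat \<Rightarrow> nat" where
  "antipodal_index m j = (if j \<le> 3 ^ m - 1 then j + (3 ^ m - 1) else j - (3 ^ m - 1))"

lemma antipodal_index_mem:
  "j \<in> {1..2 * (3 ^ m - 1)} \<Longrightarrow> antipodal_index m j \<in> {1..2 * (3 ^ m - 1)}"
  by (auto simp: antipodal_index_def)

text \<open>Indices in the range differ by less than \<open>2 * M\<close>, so the odd factor
  \<open>2 * n + 1\<close> can only be 1 or -1.\<close>

lemma antipodal_index_eqI:
  fixes n :: int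
  assumes "i \<in> {1..2 * (3 ^ m - 1)}" "j \<in> {1..2 * (3 ^ m - 1)}"
    and "int i - int j = (2 * n + 1) * (3 ^ m - 1)"
  shows "j = antipodal_index m i"
proof -
  define M :: nat where "M = 3 ^ m - 1"
  have M: "int M = 3 ^ m - 1"
    by (simp add: M_def of_nat_diff)
  have ij: "1 \<le> i" "i \<le> 2 * M" "1 \<le> j" "j \<le> 2 * M"
    using assms(1,2) by (auto simp: M_def)
  have eq: "int i - int j = (2 * n + 1) * int M"
    using assms(3) by (simp add: M)
  have "M > 0" using ij by simp
  have "\<bar>2 * n + 1\<bar> * int M < 2 * int M"
  proof -
    have "\<bar>2 * n + 1\<bar> * int M = \<bar>int i - int j\<bar>"
      unfolding eq by (simp add: abs_mult)
    also have "\<dots> < 2 * int M"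
      using ij by linarith
    finally show ?thesis .
  qed
  then have "\<bar>2 * n + 1\<bar> < 2"
    using \<open>M > 0\<close> by simp
  then have "n = 0 \<or> n = -1" by linarith
  then show ?thesis
    using eq ij unfolding antipodal_index_def M_def[symmetric] by auto
qed

lemma half_turn_node:
  assumes "m \<ge> 1" "j \<in> {1..2 * (3 ^ m - 1)}"
  shows "half_turn (node m j) = node m (antipodal_index m j)"
proof -
  define M :: nat where "M = 3 ^ m - 1"
  have M: "3 ^ m - 1 = real M"
    by (simp add: M_def of_nat_diff)
  have "(3::nat) \<le> 3 ^ m"
    using \<open>m \<ge> 1\<close> power_increasing[of 1 m "3::nat"] by simp
  then have "M > 0" unfolding M_def by linarith
  then have "real M > 0" by simp
  have index: "antipodal_index m j = (if j \<le> M then j + M else j - M)"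
    unfolding antipodal_index_def M_def ..
  show ?thesis
  proof (cases "j \<le> M")
    case True
    then have "pi * (real j - 1) / M + pi = pi * (real (antipodal_index m j) - 1) / M"
      using \<open>real M > 0\<close> by (simp add: index field_simps)
    then show ?thesis
      by (simp add: node_def half_turn.abs_eq M)
  next
    case False
    then have "pi * (real j - 1) / M + pi = pi * (real (antipodal_index m j) - 1) / M + 2 * pi"
      using \<open>real M > 0\<close> by (simp add: index of_nat_diff field_simps)
    then show ?thesis
      by (auto simp: node_def half_turn.abs_eq M abs_circle_eq_iff intro!: exI[of _ "-1"])
  qed
qed

lemma half_turn_A_points:
  assumes "m \<ge> 1"
  shows "half_turn ` A_points m = A_points m"
proof -
  have sub: "half_turn ` A_points m \<subseteq> A_points m"
    unfolding A_points_def using assms antipodal_index_mem by (auto simp: half_turn_node)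
  have "half_turn (half_turn t) = t" for t
    by (induction t rule: circle.abs_induct)
      (auto simp: half_turn.abs_eq abs_circle_eq_iff intro!: exI[of _ "-1"])
  then have "A_points m \<subseteq> half_turn ` A_points m"
    using sub by (metis image_subset_iff image_eqI subsetI)
  with sub show ?thesis by blast
qed

lemma aff_dim_closed_segment:
  fixes a b :: "'a::euclidean_space"
  shows "aff_dim (closed_segment a b) = (if a = b then 0 else 1)"
  by (simp only: segment_convex_hull aff_dim_convex_hull aff_dim_2)

lemma vertices_closed_segment:
  fixes a b :: "'a::euclidean_space"
  shows "vertices (closed_segment a b) = {a, b}"
  by (auto simp: vertices_def extreme_point_of_segment)

section \<open>The polytope of a clustered symmetric set\<close>

text \<open>Covers both polytopes of the theorem: singleton clusters (\<open>s = 1\<close>) give the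
  equally spaced points. Arcs are replaced by real representatives near the nodes, whose angles
  carry the index \<open>int j - 1\<close> because \<open>j\<close> starts at 1.\<close>

locale clustered_curve =
  fixes m s :: nat and e :: "'n::finite \<Rightarrow> nat" and A :: "circle set" and K :: "nat \<Rightarrow> circle set"
  assumes m: "m \<ge> 1"
    and e: "bij_betw e UNIV {..<2 * (m + 1)}"
    and A_eq: "A = (\<Union>j\<in>{1..2 * (3 ^ m - 1)}. K j)"
    and finite_K: "j \<in> {1..2 * (3 ^ m - 1)} \<Longrightarrow> finite (K j)"
    and card_K: "j \<in> {1..2 * (3 ^ m - 1)} \<Longrightarrow> card (K j) = s"
    and near: "\<lbrakk>j \<in> {1..2 * (3 ^ m - 1)}; t \<in> K j\<rbrakk> \<Longrightarrow>
      \<exists>x. t = abs_circle x \<and> \<bar>x - pi * of_int (int j - 1) / (3 ^ m - 1)\<bar> \<le> 1 / 10 ^ m"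
    and half_turn_A: "half_turn ` A = A"
begin

abbreviation P :: "(real ^ 'n) set" where
  "P \<equiv> curve_polytope e A"

lemma finite_A: "finite A"
  by (simp add: A_eq finite_K)

text \<open>For frequency 1 (\<open>k = 0\<close>), \<open>cluster_point_unique\<close> makes the
  index difference a multiple of \<open>2 * M\<close>, and it is smaller than
  \<open>2 * M\<close>.\<close>

lemma K_disjoint:
  assumes ij: "i \<in> {1..2 * (3 ^ m - 1)}" "j \<in> {1..2 * (3 ^ m - 1)}" and t: "t \<in> K i" "t \<in> K j"
  shows "i = j"
proof -
  obtain x where x: "t = abs_circle x" "\<bar>x - pi * of_int (int i - 1) / (3 ^ m - 1)\<bar> \<le> 1 / 10 ^ m"
    using near[OF ij(1) t(1)] by blast
  obtain y where y: "t = abs_circle y" "\<bar>y - pi * of_int (int j - 1) / (3 ^ m - 1)\<bar> \<le> 1 / 10 ^ m"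
    using near[OF ij(2) t(2)] by blast
  obtain n :: int where "y = x + of_int n * (2 * pi)"
    using x(1) y(1) abs_circle_eq_iff by metis
  then have "3 ^ 0 * (x - y) = 2 * pi * of_int (- n)"
    by simp
  then obtain l' where l': "(int i - 1) - (int j - 1) = 2 * l' * (3 ^ m - 1)"
    using cluster_point_unique[OF m _ x(2) y(2), of 0] by blast
  define M :: nat where "M = 3 ^ m - 1"
  have "int M = 3 ^ m - 1" by (simp add: M_def of_nat_diff)
  then have eq: "int i - int j = 2 * l' * int M"
    using l' by simp
  have "1 \<le> i" "i \<le> 2 * M" "1 \<le> j" "j \<le> 2 * M"
    using ij by (auto simp: M_def)
  then have "\<bar>int i - int j\<bar> < 2 * int M"
    by linarith
  then have "\<bar>l'\<bar> * (2 * int M) < 1 * (2 * int M)"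
    unfolding eq by (simp add: abs_mult)
  then have "l' = 0" by (simp only: mult_less_cancel_right) linarith
  then show ?thesis using eq by simp
qed

lemma card_A: "card A = 2 * s * (3 ^ m - 1)"
proof -
  have "card A = (\<Sum>j\<in>{1..2 * (3 ^ m - 1)}. card (K j))"
    unfolding A_eq using K_disjoint finite_K by (intro card_UN_disjoint) blast+
  also have "\<dots> = 2 * s * (3 ^ m - 1)"
    by (simp add: card_K)
  finally show ?thesis .
qed

lemma polytope_P: "polytope P"
  unfolding polytope_def curve_polytope_def using finite_A by blast

lemma centrally_symmetric_P: "centrally_symmetric P"
proof -
  have "uminus ` P = convex hull (uminus ` Phi e ` A)"
    unfolding curve_polytope_def by (intro convex_hull_linear_image linear_uminus)
  also have "uminus ` Phi e ` A = Phi e ` half_turn ` A"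
    by (simp add: image_image Phi_half_turn)
  finally show ?thesis
    by (simp add: centrally_symmetric_def half_turn_A curve_polytope_def)
qed

text \<open>The functional uses only the frequencies \<open>3 ^ k\<close> and
  \<open>3 ^ Suc k\<close>, both present because \<open>k < m\<close>. It is maximal wherever
  \<open>3 ^ k * t\<close> agrees with \<open>3 ^ k * x\<close> or \<open>3 ^ k * y\<close> modulo
  \<open>2 * pi\<close>; within \<open>A\<close> this leaves just the two given points.\<close>

lemma segment_face_of_P:
  assumes ij: "i \<in> {1..2 * (3 ^ m - 1)}" "j \<in> {1..2 * (3 ^ m - 1)}"
    and x: "abs_circle x \<in> K i" "\<bar>x - pi * of_int (int i - 1) / (3 ^ m - 1)\<bar> \<le> 1 / 10 ^ m"
    and y: "abs_circle y \<in> K j" "\<bar>y - pi * of_int (int j - 1) / (3 ^ m - 1)\<bar> \<le> 1 / 10 ^ m"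
    and k: "k < m" "cos (3 ^ k * (x - y)) > - (1 / 2)"
  shows "closed_segment (Phi e (abs_circle x)) (Phi e (abs_circle y)) face_of P"
proof -
  have "cos (3 ^ k * x - 3 ^ k * y) > - (1 / 2)"
    using k(2) by (simp add: right_diff_distrib)
  then obtain a1 b1 a3 b3 d where T: "\<And>t.
      a1 * cos t + b1 * sin t + a3 * cos (3 * t) + b3 * sin (3 * t) \<le> d \<and>
      (a1 * cos t + b1 * sin t + a3 * cos (3 * t) + b3 * sin (3 * t) = d
        \<longleftrightarrow> (\<exists>n::int. t = 3 ^ k * x + 2 * pi * n \<or> t = 3 ^ k * y + 2 * pi * n))"
    using ex_trig_two_zeros by meson
  define a where "a = (\<lambda>i. if i = k then a1 else if i = Suc k then a3 else 0)"
  define b where "b = (\<lambda>i. if i = k then b1 else if i = Suc k then b3 else 0)"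
  define v where "v = trig_vec e a b"
  have v: "v \<bullet> Phi e (abs_circle t) = a1 * cos (3 ^ k * t) + b1 * sin (3 ^ k * t)
      + a3 * cos (3 * (3 ^ k * t)) + b3 * sin (3 * (3 ^ k * t))" for t
  proof -
    have "v \<bullet> Phi e (abs_circle t) = (\<Sum>i\<in>{k, Suc k}. a i * cos (3 ^ i * t) + b i * sin (3 ^ i * t))"
      unfolding v_def inner_trig_vec_Phi[OF e] using k(1)
      by (intro sum.mono_neutral_right) (auto simp: a_def b_def)
    then show ?thesis
      by (simp add: a_def b_def mult.assoc)
  qed
  have le: "v \<bullet> Phi e t \<le> d" for t
    by (induction t rule: circle.abs_induct) (simp add: v T)
  \<comment> \<open>Of the \<open>3 ^ k\<close> circle points with the same
    \<open>3 ^ k\<close>-fold angle, \<open>A\<close> contains only one. The arbitrary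
    representative \<open>u\<close> is first exchanged for one near a node, which changes
    \<open>n\<close> by \<open>3 ^ k * n'\<close>.\<close>
  have uniq: "t = abs_circle z"
    if t: "t \<in> A" and tu: "t = abs_circle u" "3 ^ k * u = 3 ^ k * z + 2 * pi * n"
      and l: "l \<in> {1..2 * (3 ^ m - 1)}" "\<bar>z - pi * of_int (int l - 1) / (3 ^ m - 1)\<bar> \<le> 1 / 10 ^ m"
    for t u z l and n :: int
  proof -
    obtain h where h: "h \<in> {1..2 * (3 ^ m - 1)}" "t \<in> K h"
      using t unfolding A_eq by blast
    obtain w where w: "t = abs_circle w" "\<bar>w - pi * of_int (int h - 1) / (3 ^ m - 1)\<bar> \<le> 1 / 10 ^ m"
      using near[OF h] by blast
    obtain n' :: int where n': "w = u + of_int n' * (2 * pi)"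
      using w(1) tu(1) abs_circle_eq_iff by metis
    have "3 ^ k * (w - z) = 2 * pi * of_int (n + 3 ^ k * n')"
      using tu(2) by (simp add: n' algebra_simps)
    then obtain l' :: int where "w - z = 2 * pi * l'"
      using cluster_point_unique[OF m _ w(2) l(2), of k] k(1) by (metis less_imp_le)
    then show ?thesis
      unfolding w(1) abs_circle_eq_iff by (intro exI[of _ "- l'"]) (simp add: algebra_simps)
  qed
  have "v \<bullet> Phi e t = d \<longleftrightarrow> t = abs_circle x \<or> t = abs_circle y" if t: "t \<in> A" for t
  proof
    assume *: "v \<bullet> Phi e t = d"
    obtain u where u: "t = abs_circle u"
      using circle.abs_induct[of "\<lambda>s. \<exists>x. s = abs_circle x"] by blast
    from * obtain n :: int where "3 ^ k * u = 3 ^ k * x + 2 * pi * n \<or> 3 ^ k * u = 3 ^ k * y + 2 * pi * n"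
      using T[of "3 ^ k * u"] unfolding u v by blast
    then show "t = abs_circle x \<or> t = abs_circle y"
      using uniq[OF t u _ ij(1) x(2)] uniq[OF t u _ ij(2) y(2)] by blast
  next
    have "3 ^ k * z = 3 ^ k * z + 2 * pi * of_int 0" for z :: real by simp
    then have "v \<bullet> Phi e (abs_circle x) = d" "v \<bullet> Phi e (abs_circle y) = d"
      unfolding v using T by blast+
    then show "t = abs_circle x \<or> t = abs_circle y \<Longrightarrow> v \<bullet> Phi e t = d" by blast
  qed
  moreover have "abs_circle x \<in> A" "abs_circle y \<in> A"
    using ij x(1) y(1) unfolding A_eq by blast+
  ultimately have "{z \<in> Phi e ` A. v \<bullet> z = d} = {Phi e (abs_circle x), Phi e (abs_circle y)}"
    by auto
  then show ?thesis
    using face_of_convex_hull_Int_hyperplane[of "Phi e ` A" v d] finite_A le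
    by (auto simp: segment_convex_hull curve_polytope_def)
qed

lemma vertices_P: "vertices P = Phi e ` A"
proof
  show "vertices P \<subseteq> Phi e ` A"
    by (auto simp: vertices_def curve_polytope_def dest: extreme_point_of_convex_hull)
  show "Phi e ` A \<subseteq> vertices P"
  proof safe
    fix t assume "t \<in> A"
    then obtain j where j: "j \<in> {1..2 * (3 ^ m - 1)}" "t \<in> K j"
      unfolding A_eq by blast
    from near[OF this] obtain x where x: "t = abs_circle x"
      "\<bar>x - pi * of_int (int j - 1) / (3 ^ m - 1)\<bar> \<le> 1 / 10 ^ m" by blast
    \<comment> \<open>For equal endpoints the cosine is 1, and the segment is a single
      point.\<close>
    have "closed_segment (Phi e t) (Phi e t) face_of P"
      using segment_face_of_P[OF j(1) j(1) _ x(2) _ x(2), of 0] j m unfolding x(1) by simp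
    then show "Phi e t \<in> vertices P"
      by (simp add: vertices_def face_of_singleton)
  qed
qed

lemma card_vertices_P: "card (vertices P) = card A"
  unfolding vertices_P using inj_Phi[OF e] by (intro card_image) (auto intro: inj_on_subset)

lemma non_antipodal_segment_face_of_P:
  assumes i: "i \<in> {1..2 * (3 ^ m - 1)}" "t \<in> K i" and u: "u \<in> A" "u \<notin> K (antipodal_index m i)"
  shows "closed_segment (Phi e t) (Phi e u) face_of P"
proof -
  obtain x where x: "t = abs_circle x" "\<bar>x - pi * of_int (int i - 1) / (3 ^ m - 1)\<bar> \<le> 1 / 10 ^ m"
    using near[OF i] by blast
  obtain j where j: "j \<in> {1..2 * (3 ^ m - 1)}" "u \<in> K j"
    using u(1) unfolding A_eq by blast
  obtain y where y: "u = abs_circle y" "\<bar>y - pi * of_int (int j - 1) / (3 ^ m - 1)\<bar> \<le> 1 / 10 ^ m"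
    using near[OF j] by blast
  show ?thesis
  proof (rule ccontr)
    assume "\<not> ?thesis"
    then have "cos (3 ^ k * (x - y)) \<le> - (1 / 2)" if "k < m" for k
      using segment_face_of_P[OF i(1) j(1) _ x(2) _ y(2) that] i j x y by force
    then obtain n :: int where "(int i - 1) - (int j - 1) = (2 * n + 1) * (3 ^ m - 1)"
      using near_antipode_clusters[OF m x(2) y(2)] by blast
    then have "j = antipodal_index m i"
      by (intro antipodal_index_eqI[OF i(1) j(1), of n]) simp
    with u(2) j(2) show False by simp
  qed
qed

text \<open>If the points lay on a hyperplane \<open>v \<bullet> z = d\<close>, the symmetry of
  \<open>A\<close> would force \<open>d = 0\<close>, so the trigonometric sum with the coefficients
  of \<open>v\<close> would vanish on \<open>A\<close>. That this is impossible is a hypothesis,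
  since the two point sets require different arguments for it.\<close>

lemma aff_dim_P:
  assumes indep: "\<And>a b k. \<lbrakk>\<And>t. abs_circle t \<in> A \<Longrightarrow>
      (\<Sum>k\<le>m. a k * cos (3 ^ k * t) + b k * sin (3 ^ k * t)) = 0; k \<le> m\<rbrakk> \<Longrightarrow> a k = 0 \<and> b k = 0"
  shows "aff_dim P = 2 * (int m + 1)"
proof -
  have dim: "DIM(real ^ 'n) = 2 * (m + 1)"
    using bij_betw_same_card[OF e] by simp
  have "\<not> aff_dim (Phi e ` A) < DIM(real ^ 'n)"
  proof
    assume "aff_dim (Phi e ` A) < DIM(real ^ 'n)"
    then obtain v d where v: "v \<noteq> 0" "Phi e ` A \<subseteq> {x. v \<bullet> x = d}"
      by (rule aff_lowdim_subset_hyperplane)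
    obtain a b where ab: "v = trig_vec e a b"
      using trig_vec_surj[OF bij_betw_imp_inj_on[OF e]] .
    have "v \<bullet> Phi e t = 0" if t: "t \<in> A" for t
    proof -
      have "half_turn t \<in> A" using t half_turn_A by blast
      then have "v \<bullet> Phi e t = d" "v \<bullet> - Phi e t = d"
        using v(2) t by (auto simp flip: Phi_half_turn)
      then show ?thesis by simp
    qed
    then have "(\<Sum>k\<le>m. a k * cos (3 ^ k * t) + b k * sin (3 ^ k * t)) = 0" if "abs_circle t \<in> A" for t
      using that by (simp add: ab flip: inner_trig_vec_Phi[OF e])
    then have zero: "a k = 0 \<and> b k = 0" if "k \<le> m" for k
      using indep that by blast
    have "e i div 2 \<le> m" for i
      using bij_betwE[OF e] by (metis UNIV_I lessThan_iff less_mult_imp_div_less mult.commute less_Suc_eq_le Suc_eq_plus1)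
    then have "v = 0"
      unfolding ab trig_vec_def using zero by (simp add: vec_eq_iff)
    with v(1) show False ..
  qed
  moreover have "aff_dim (Phi e ` A) \<le> DIM(real ^ 'n)"
    by (rule aff_dim_le_DIM)
  ultimately have "aff_dim (Phi e ` A) = int (2 * (m + 1))"
    unfolding dim by linarith
  then show ?thesis
    by (simp add: curve_polytope_def aff_dim_convex_hull)
qed

text \<open>Double counting: each point is joined by edges to all points other than itself and the
  \<open>s\<close> points of the opposite cluster, and every edge has two ends.\<close>

lemma card_edges_P: "card A * (card A - 1 - s) \<le> 2 * card {F. F edge_of P}"
proof -
  obtain c where c: "c t \<in> {1..2 * (3 ^ m - 1)}" "t \<in> K (c t)" if "t \<in> A" for t
    using A_eq by (metis UN_E)
  define N where "N = (\<lambda>t. A - insert t (K (antipodal_index m (c t))))"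
  \<comment> \<open>An ordered pair becomes an edge with a marked endpoint. The mark makes the map
    injective, and each edge has two possible marks.\<close>
  define f where "f = (\<lambda>(t, u). (closed_segment (Phi e t) (Phi e u), Phi e t))"
  have card_N: "card A - 1 - s \<le> card (N t)" if "t \<in> A" for t
  proof -
    have c': "antipodal_index m (c t) \<in> {1..2 * (3 ^ m - 1)}"
      using antipodal_index_mem[OF c(1)[OF that]] .
    have "card (insert t (K (antipodal_index m (c t)))) \<le> Suc s"
      using card_insert_le_m1[of "Suc s"] by (simp add: card_K[OF c'] card_insert_if finite_K[OF c'])
    moreover have "card A - card (insert t (K (antipodal_index m (c t)))) \<le> card (N t)"
      unfolding N_def using finite_K[OF c'] by (intro diff_card_le_card_Diff) simp
    ultimately show ?thesis by simp
  qed
  define S where "S = (SIGMA t:A. N t)"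
  define E where "E = fst ` f ` S"
  have Phi_eq: "Phi e t = Phi e u \<longleftrightarrow> t = u" for t u
    using inj_Phi[OF e] by (rule inj_eq)
  have edge: "closed_segment (Phi e t) (Phi e u) face_of P" "Phi e t \<noteq> Phi e u"
    if "(t, u) \<in> S" for t u
  proof -
    have t: "t \<in> A" and u: "u \<in> A" "u \<noteq> t" "u \<notin> K (antipodal_index m (c t))"
      using that by (auto simp: S_def N_def)
    show "closed_segment (Phi e t) (Phi e u) face_of P"
      by (rule non_antipodal_segment_face_of_P[OF c[OF t] u(1,3)])
    show "Phi e t \<noteq> Phi e u"
      using u(2) by (simp add: Phi_eq)
  qed
  have E_cases: "\<exists>t u. (t, u) \<in> S \<and> F = closed_segment (Phi e t) (Phi e u)" if "F \<in> E" for F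
    using that unfolding E_def f_def by fastforce
  have "E \<subseteq> {F. F edge_of P}"
    using edge by (auto simp: edge_of_def aff_dim_closed_segment dest!: E_cases)
  moreover have "finite {F. F edge_of P}"
    using finite_polytope_faces[OF polytope_P] by (rule rev_finite_subset) (auto simp: edge_of_def)
  ultimately have fin_E: "finite E" and card_E: "card E \<le> card {F. F edge_of P}"
    by (simp_all add: finite_subset card_mono)
  have vertices_E: "finite (vertices F)" "card (vertices F) = 2" if F: "F \<in> E" for F
  proof -
    obtain t u where "(t, u) \<in> S" "F = closed_segment (Phi e t) (Phi e u)"
      using E_cases[OF F] by blast
    then show "finite (vertices F)" "card (vertices F) = 2"
      using edge(2)[of t u] by (simp_all add: vertices_closed_segment)
  qed
  have "inj_on f S"
  proof (rule inj_onI)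
    fix p q assume eq: "f p = f q"
    obtain t u where p: "p = (t, u)" by (cases p)
    obtain t' u' where q: "q = (t', u')" by (cases q)
    have "closed_segment (Phi e t) (Phi e u) = closed_segment (Phi e t') (Phi e u')" "Phi e t = Phi e t'"
      using eq unfolding p q f_def prod.case prod.inject by blast+
    then have "{Phi e t, Phi e u} = {Phi e t', Phi e u'}" and t: "t = t'"
      by (metis vertices_closed_segment, metis Phi_eq)
    then have "u = u'"
      using t by (auto simp: doubleton_eq_iff Phi_eq)
    with t show "p = q" by (simp add: p q)
  qed
  moreover have "f p \<in> (SIGMA F:E. vertices F)" if "p \<in> S" for p
  proof -
    have "fst (f p) \<in> E"
      unfolding E_def using that by (intro imageI)
    moreover have "snd (f p) \<in> vertices (fst (f p))"
      by (simp add: f_def vertices_closed_segment split: prod.split)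
    ultimately show ?thesis
      unfolding mem_Sigma_iff[of "fst (f p)" "snd (f p)", unfolded prod.collapse] by blast
  qed
  then have "f ` S \<subseteq> (SIGMA F:E. vertices F)"
    by (rule image_subsetI)
  ultimately have "card S \<le> card (SIGMA F:E. vertices F)"
    using fin_E vertices_E(1) by (intro card_inj_on_le) auto
  also have "\<dots> = 2 * card E"
    using fin_E vertices_E by simp
  finally have "card S \<le> 2 * card {F. F edge_of P}"
    using card_E by simp
  moreover have "card A * (card A - 1 - s) \<le> (\<Sum>t\<in>A. card (N t))"
    using sum_bounded_below[of A "card A - 1 - s" "\<lambda>t. card (N t)"] card_N by simp
  moreover have "card S = (\<Sum>t\<in>A. card (N t))"
    unfolding S_def using finite_A by (intro card_SigmaI) (auto simp: N_def)
  ultimately show ?thesis by simp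
qed

end

section \<open>Vanishing trigonometric sums on the two point sets\<close>

text \<open>Writing \<open>3 ^ m\<close> as \<open>1 + (3 ^ m - 1)\<close>, the second summand
  contributes \<open>pi\<close> times the index \<open>2 * i + c\<close>; modulo
  \<open>2 * pi\<close> only \<open>pi * c\<close> remains.\<close>

lemma three_power_mult_node:
  fixes m c i :: nat
  assumes "m \<ge> 1"
  shows "3 ^ m * (pi * real (2 * i + c) / (3 ^ m - 1))
    = pi * real (2 * i + c) / (3 ^ m - 1) + 2 * pi * i + pi * c"
proof -
  have "(3::real) ^ m > 1"
    using assms by (simp add: one_less_power)
  then show ?thesis
    by (simp add: field_simps)
qed

text \<open>On every second node the frequencies \<open>1\<close> and \<open>3\<^sup>m\<close> agree up to the sign \<open>(-1)\<^sup>c\<close>, so the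
  degree drops to \<open>3\<^sup>m\<^sup>-\<^sup>1\<close>.\<close>

lemma trig_sum_zero_on_half_nodes:
  fixes a b :: "nat \<Rightarrow> real" and c :: nat
  assumes "m \<ge> 2"
    and zero: "\<And>i. i < 3 ^ m - 1 \<Longrightarrow>
      (\<Sum>k\<le>m. a k * cos (3 ^ k * (pi * real (2 * i + c) / (3 ^ m - 1)))
        + b k * sin (3 ^ k * (pi * real (2 * i + c) / (3 ^ m - 1)))) = 0"
    and "k < m"
  shows "(if k = 0 then a 0 + (-1) ^ c * a m else a k) = 0"
    and "(if k = 0 then b 0 + (-1) ^ c * b m else b k) = 0"
proof -
  obtain d where d: "m = Suc d" "d \<ge> 1"
    using \<open>m \<ge> 2\<close> by (cases m) auto
  define x where "x = (\<lambda>i. pi * real (2 * i + c) / (3 ^ m - 1))"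
  \<comment> \<open>The top frequency \<open>3 ^ m\<close> is folded into frequency 1, with the sign
    from \<open>top\<close>.\<close>
  define a' where "a' = (\<lambda>k. if k = 0 then a 0 + (-1) ^ c * a m else a k)"
  define b' where "b' = (\<lambda>k. if k = 0 then b 0 + (-1) ^ c * b m else b k)"
  have top: "cos (3 ^ m * x i) = (-1) ^ c * cos (x i)" "sin (3 ^ m * x i) = (-1) ^ c * sin (x i)" for i
  proof -
    have "3 ^ m * x i = x i + 2 * pi * of_int (int i) + pi * c"
      unfolding x_def using \<open>m \<ge> 2\<close> by (subst three_power_mult_node) auto
    moreover have "cos (y + pi * c) = (-1) ^ c * cos y" "sin (y + pi * c) = (-1) ^ c * sin y" for y
      by (simp_all add: cos_add sin_add)
    ultimately show "cos (3 ^ m * x i) = (-1) ^ c * cos (x i)" "sin (3 ^ m * x i) = (-1) ^ c * sin (x i)"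
      by (simp_all only: cos_add[of "x i"] sin_add[of "x i"] cos_int_2pin sin_int_2pin) simp_all
  qed
  have "(\<Sum>k\<le>d. a' k * cos (3 ^ k * x i) + b' k * sin (3 ^ k * x i)) = 0" if "i < 3 ^ m - 1" for i
  proof -
    have "(\<Sum>k\<le>d. a' k * cos (3 ^ k * x i) + b' k * sin (3 ^ k * x i))
        = (\<Sum>k\<le>m. a k * cos (3 ^ k * x i) + b k * sin (3 ^ k * x i))"
    proof -
      have "a' k * cos (3 ^ k * x i) + b' k * sin (3 ^ k * x i)
          = (a k * cos (3 ^ k * x i) + b k * sin (3 ^ k * x i))
            + (if k = 0 then a m * cos (3 ^ m * x i) + b m * sin (3 ^ m * x i) else 0)" for k
        unfolding top by (simp add: a'_def b'_def algebra_simps)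
      then show ?thesis
        by (simp add: sum.distrib d(1))
    qed
    then show ?thesis
      using zero[OF that] by (simp add: x_def)
  qed
  moreover have "inj_on (\<lambda>i. cis (x i)) {..<3 ^ m - 1}"
  proof (rule inj_onI)
    fix i j :: nat assume ij: "i \<in> {..<3 ^ m - 1}" "j \<in> {..<3 ^ m - 1}" and "cis (x i) = cis (x j)"
    then obtain n :: int where n: "x j = x i + of_int n * (2 * pi)"
      by (auto simp: cis_eq_iff rcong_altdef)
    have M: "(3::real) ^ m - 1 = of_int (int (3 ^ m - 1))"
      by (simp add: of_nat_diff)
    have "(3::real) ^ m - 1 > 0"
      using \<open>m \<ge> 2\<close> by (simp add: one_less_power)
    then have "2 * pi * (real j - (real i + n * (3 ^ m - 1))) = 0"
      using n unfolding x_def by (simp add: field_simps)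
    then have "real_of_int (int j) = of_int (int i + n * int (3 ^ m - 1))"
      unfolding M by simp
    then have eq: "int j = int i + n * int (3 ^ m - 1)"
      by (simp only: of_int_eq_iff)
    have "\<bar>int j - int i\<bar> < 1 * int (3 ^ m - 1)"
      using ij unfolding lessThan_iff by linarith
    then have "\<bar>n\<bar> * int (3 ^ m - 1) < 1 * int (3 ^ m - 1)"
      unfolding eq by (simp add: abs_mult)
    then have "n = 0" by (simp only: mult_less_cancel_right) linarith
    then show "i = j" using eq by simp
  qed
  moreover have "card {..<(3::nat) ^ m - 1} > 2 * 3 ^ d"
  proof -
    \<comment> \<open>The number of points exceeds \<open>2 * 3 ^ d\<close> by
      \<open>3 ^ d - 1\<close>, which is positive because \<open>m \<ge> 2\<close>.\<close>
    have "(3::nat) ^ 1 \<le> 3 ^ d"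
      using d(2) by (intro power_increasing) auto
    then show ?thesis by (simp add: d(1))
  qed
  ultimately have "a' k = 0" "b' k = 0"
    using trig_sum_eq_0_imp[of d "{..<3 ^ m - 1}" x a' b' k] \<open>k < m\<close> d(1) by auto
  then show "(if k = 0 then a 0 + (-1) ^ c * a m else a k) = 0"
    "(if k = 0 then b 0 + (-1) ^ c * b m else b k) = 0"
    by (simp_all add: a'_def b'_def)
qed

text \<open>The set has only \<open>2 * (3 ^ m - 1)\<close> points, too few to count zeros of degree
  \<open>3 ^ m\<close> directly. The even and odd nodes separately give \<open>a 0 + a m = 0\<close>
  and \<open>a 0 - a m = 0\<close>, likewise for \<open>b\<close>, and this separates the two merged
  frequencies.\<close>

lemma trig_sum_zero_on_A_points:
  fixes a b :: "nat \<Rightarrow> real"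
  assumes "m \<ge> 2"
    and zero: "\<And>t. abs_circle t \<in> A_points m \<Longrightarrow>
      (\<Sum>k\<le>m. a k * cos (3 ^ k * t) + b k * sin (3 ^ k * t)) = 0"
    and "k \<le> m"
  shows "a k = 0 \<and> b k = 0"
proof -
  have node: "(\<Sum>k\<le>m. a k * cos (3 ^ k * (pi * real (2 * i + c) / (3 ^ m - 1)))
        + b k * sin (3 ^ k * (pi * real (2 * i + c) / (3 ^ m - 1)))) = 0"
    if "i < 3 ^ m - 1" "c \<le> 1" for i c
  proof (rule zero)
    have "abs_circle (pi * real (2 * i + c) / (3 ^ m - 1)) = node m (2 * i + c + 1)"
      by (simp add: node_def)
    moreover have "2 * i + c + 1 \<in> {1..2 * (3 ^ m - 1)}"
      using that by auto
    ultimately show "abs_circle (pi * real (2 * i + c) / (3 ^ m - 1)) \<in> A_points m"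
      unfolding A_points_def by blast
  qed
  have "(if k = 0 then a 0 + (-1) ^ c * a m else a k) = 0 \<and> (if k = 0 then b 0 + (-1) ^ c * b m else b k) = 0"
    if "k < m" "c \<le> 1" for k c
    using trig_sum_zero_on_half_nodes[OF \<open>m \<ge> 2\<close> node] that by blast
  from this[of 0 0] this[of 0 1] this[of k 0]
  show ?thesis
    using \<open>m \<ge> 2\<close> \<open>k \<le> m\<close> by (cases "k = 0"; cases "k = m") auto
qed

lemma trig_sum_zero_on_circle:
  fixes a b :: "nat \<Rightarrow> real"
  assumes "card A > 2 * 3 ^ m"
    and zero: "\<And>t. abs_circle t \<in> A \<Longrightarrow>
      (\<Sum>k\<le>m. a k * cos (3 ^ k * t) + b k * sin (3 ^ k * t)) = 0"
    and "k \<le> m"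
  shows "a k = 0 \<and> b k = 0"
proof -
  have rep: "abs_circle (rep_circle t) = t" for t
    by (rule Quotient_abs_rep[OF Quotient_circle])
  have "inj_on (\<lambda>t. cis (rep_circle t)) A"
    by (rule inj_onI) (metis cis_eq_iff circle.abs_eq_iff rep)
  then show ?thesis
    using trig_sum_eq_0_imp[OF assms(1) _ _ \<open>k \<le> m\<close>, of rep_circle a b] zero rep by auto
qed

section \<open>Assembly and the numerical estimates\<close>

theorem theorem3p2:
  fixes m s :: nat and e :: "'n::finite \<Rightarrow> nat" and A :: "circle set"
  assumes "m \<ge> 2" and "s \<ge> 2"
    and "bij_betw e UNIV {..<2 * (m + 1)}"
    and "clustered m s A"
  shows "(let P = curve_polytope e (A_points m) in
            cs_neighborly 2 P \<and>
            aff_dim P = 2 * (int m + 1) \<and>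
            card (vertices P) = 2 * (3 ^ m - 1)) \<and>
         (let P = curve_polytope e A; N = 2 * s * (3 ^ m - 1) in
            polytope P \<and> centrally_symmetric P \<and>
            aff_dim P = 2 * (int m + 1) \<and>
            card (vertices P) = N \<and>
            real (card {F. F edge_of P}) \<ge> real N * (real N - real s - 1) / 2 \<and>
            real N * (real N - real s - 1) / 2 > (1 - 1 / 3 ^ m) * real (N choose 2))"
proof -
  have m: "m \<ge> 1" using assms(1) by simp
  have pow: "(3::nat) ^ m \<ge> 9"
    using power_increasing[of 2 m "3::nat"] assms(1) by simp
  interpret A1: clustered_curve m 1 e "A_points m" "\<lambda>j. {node m j}"
  proof
    show "A_points m = (\<Union>j\<in>{1..2 * (3 ^ m - 1)}. {node m j})"
      by (auto simp: A_points_def)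
    show "\<exists>x. t = abs_circle x \<and> \<bar>x - pi * of_int (int j - 1) / (3 ^ m - 1)\<bar> \<le> 1 / 10 ^ m"
      if "t \<in> {node m j}" for t j
      using that by (intro exI[of _ "pi * (real j - 1) / (3 ^ m - 1)"]) (simp add: node_def)
  qed (use m assms(3) half_turn_A_points in auto)
  have neighborly: "cs_neighborly 2 A1.P"
    unfolding cs_neighborly_def
  proof (intro conjI allI impI A1.polytope_P A1.centrally_symmetric_P)
    fix V assume V: "V \<subseteq> vertices A1.P \<and> card V = 2 \<and> pairwise (\<lambda>v w. w \<noteq> - v) V"
    then obtain v w where vw: "V = {v, w}" "v \<noteq> w"
      by (auto simp: card_2_iff)
    then obtain t u where tu: "t \<in> A_points m" "v = Phi e t" "u \<in> A_points m" "w = Phi e u"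
      using V by (auto simp: A1.vertices_P)
    obtain i where i: "i \<in> {1..2 * (3 ^ m - 1)}" "t = node m i"
      using tu(1) by (auto simp: A_points_def)
    have "w \<noteq> - v"
      using V vw by (simp add: pairwise_def)
    \<comment> \<open>With singleton clusters the opposite cluster consists of the antipode
      alone.\<close>
    then have "u \<noteq> node m (antipodal_index m i)"
      using half_turn_node[OF m i(1)] unfolding tu i(2) by (metis Phi_half_turn)
    then have "closed_segment v w face_of A1.P"
      using A1.non_antipodal_segment_face_of_P[OF i(1)] tu i(2) by simp
    then show "\<exists>F. F face_of A1.P \<and> aff_dim F = int 2 - 1 \<and> vertices F = V"
      using vw by (intro exI[of _ "closed_segment v w"])
        (simp add: aff_dim_closed_segment vertices_closed_segment)
  qed
  from assms(4) have half: "half_turn ` A = A"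
    unfolding clustered_def by (rule conjunct2)
  from assms(4)[unfolded clustered_def] obtain K where K: "A = (\<Union>j\<in>{1..2 * (3 ^ m - 1)}. K j)"
    "\<forall>j\<in>{1..2 * (3 ^ m - 1)}. finite (K j) \<and> card (K j) = s \<and>
      (\<exists>I. circle_arc (1 / 10 ^ m) I \<and> node m j \<in> I \<and> K j \<subseteq> I)"
    by (elim conjE exE)
  interpret A2: clustered_curve m s e A K
  proof
    fix j t assume j: "j \<in> {1..2 * (3 ^ m - 1)}" and t: "t \<in> K j"
    then obtain I where "circle_arc (1 / 10 ^ m) I" "node m j \<in> I" "t \<in> I"
      using K(2) by blast
    then show "\<exists>x. t = abs_circle x \<and> \<bar>x - pi * of_int (int j - 1) / (3 ^ m - 1)\<bar> \<le> 1 / 10 ^ m"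
      by (rule near_node)
  next
    fix j :: nat assume j: "j \<in> {1..2 * (3 ^ m - 1)}"
    show "finite (K j)" "card (K j) = s"
      using K(2) j by blast+
  qed (fact m assms(3) K(1) half)+
  define N where "N = 2 * s * (3 ^ m - 1)"
  have card_A: "card A = N"
    by (simp add: A2.card_A N_def)
  \<comment> \<open>At least two points per cluster give more than \<open>2 * 3 ^ m\<close> points,
    so zeros can be counted directly.\<close>
  have "N \<ge> 2 * 2 * (3 ^ m - 1)"
    unfolding N_def using assms(2) by (intro mult_right_mono) auto
  then have "2 * 3 ^ m < card A"
    unfolding card_A using pow by simp
  then have dim: "aff_dim A2.P = 2 * (int m + 1)"
    by (intro A2.aff_dim_P) (rule trig_sum_zero_on_circle)
  have N_real: "real N = 2 * real s * (3 ^ m - 1)"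
    by (simp add: N_def of_nat_diff)
  \<comment> \<open>This ensures that the natural number \<open>N - 1 - s\<close> is not truncated
    and agrees with the real difference.\<close>
  have "s * 8 \<le> s * (3 ^ m - 1)"
    using pow by (intro mult_left_mono) auto
  then have N_ge: "N \<ge> 1 + s" "N > 0"
    using assms(2) unfolding N_def by linarith+
  have "N * (N - 1 - s) \<le> 2 * card {F. F edge_of A2.P}"
    using A2.card_edges_P unfolding card_A .
  then have "real N * real (N - 1 - s) \<le> 2 * real (card {F. F edge_of A2.P})"
    by (metis of_nat_le_iff of_nat_mult of_nat_numeral)
  moreover have "real (N - 1 - s) = real N - real s - 1"
    using N_ge by (simp add: of_nat_diff)
  ultimately have "real N * (real N - real s - 1) \<le> 2 * real (card {F. F edge_of A2.P})"
    by (simp only:)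
  then have edges: "real (card {F. F edge_of A2.P}) \<ge> real N * (real N - real s - 1) / 2"
    by linarith
  \<comment> \<open>Equivalent to \<open>3 ^ m * s < N - 1\<close>, which for
    \<open>N = 2 * s * (3 ^ m - 1)\<close> means \<open>s * (3 ^ m - 2) > 1\<close>.\<close>
  have "(1 - 1 / 3 ^ m) * (real N - 1) < real N - real s - 1"
  proof -
    have "(3::real) ^ m \<ge> 9"
      using power_increasing[of 2 m "3::real"] assms(1) by simp
    then have "2 * 7 \<le> real s * (3 ^ m - 2)"
      using assms(2) by (intro mult_mono) auto
    then have "3 ^ m * real s < real N - 1"
      unfolding N_real by (simp add: algebra_simps)
    then show ?thesis
      by (simp add: field_simps)
  qed
  then have less: "real N * ((1 - 1 / 3 ^ m) * (real N - 1)) < real N * (real N - real s - 1)"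
    using N_ge by (intro mult_strict_left_mono) auto
  have choose: "real (N choose 2) = real N * (real N - 1) / 2"
  proof -
    have "2 dvd N * (N - 1)" by (cases N) simp_all
    then show ?thesis
      using N_ge by (simp add: choose_two real_of_nat_div of_nat_diff)
  qed
  have "real N * (real N - real s - 1) / 2 > (1 - 1 / 3 ^ m) * real (N choose 2)"
  proof -
    have "(1 - 1 / 3 ^ m) * (real N * (real N - 1) / 2) = real N * ((1 - 1 / 3 ^ m) * (real N - 1)) / 2"
      by (simp only: times_divide_eq_right mult.left_commute)
    then show ?thesis
      unfolding choose using divide_strict_right_mono[OF less, of 2] by (simp only: zero_less_numeral simp_thms)
  qed
  moreover have "aff_dim A1.P = 2 * (int m + 1)"
    using trig_sum_zero_on_A_points[OF assms(1)] by (intro A1.aff_dim_P) blast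
  ultimately show ?thesis
    using neighborly A1.card_vertices_P A1.card_A A2.polytope_P A2.centrally_symmetric_P dim
      A2.card_vertices_P card_A edges
    unfolding Let_def N_def[symmetric] by simp
qed

end
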